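(* Let $M$ be an orientable surface in $\mathbb S^3$ oriented with respect to a unit normal vector field $\eta$ and let $\mathcal N:M\to\mathbb S^5\subseteq\mathfrak o(4)$ be its Gauss map. Then for any $p\in M$ and $X,Y\in T_pM$, $$\langle d\mathcal N_p(X),\Gamma_p(Y)\rangle=-\langle A_\eta(X),Y\rangle,$$ where $A_\eta$ is the shape operator of $M$.
   Context: $O(4)$ carries the bi-invariant metric $\langle u,v\rangle=\frac12\operatorname{tr}(uv^T)$ on its Lie algebra $\mathfrak o(4)$ of skew-symmetric $4\times4$ matrices; $O(3)$ is the subgroup fixing $e_1\in\mathbb R^4$, and $\mathbb S^3=O(4)/O(3)$ isometrically via $\pi(x)=x e_1$. $\mathbb S^5$ is the unit sphere of $\mathfrak o(4)$. For $x\in O(4)$ let $\ell_x$ be the restriction of $d\pi_x$ to $(T_x(xO(3)))^\perp$, a linear isometry onto $T_{\pi(x)}\mathbb S^3$. For $p\in\mathbb S^3$, $\Gamma_p:T_p\mathbb S^3\to\mathfrak o(4)$ is $\Gamma_p(u)=d(R_{x^{-1}})_x\ell_x^{-1}(u)$ for any $x\in\pi^{-1}(p)$, where $R_y(z)=zy$ (independent of $x$). Surfaces are immersed, and points of $M$ are identified with their images. The Gauss map is $\mathcal N(p)=\Gamma_p(\eta(p))$. The shape operator is $A_\eta(X)=-\nabla_X\eta$. *)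

theory Defs
  imports "HOL-Analysis.Analysis"
begin

section \<open>Smooth maps and submanifolds of Euclidean spaces\<close>

text \<open>Only meaningful for open \<open>U\<close>: on an open set of a finite-dimensional space, continuity of
  all iterated directional derivatives is equivalent to being \<open>k\<close> times continuously differentiable.\<close>

primrec Ck_on :: "nat \<Rightarrow> ('a::euclidean_space \<Rightarrow> 'b::euclidean_space) \<Rightarrow> 'a set \<Rightarrow> bool" where
  "Ck_on 0 F U \<longleftrightarrow> continuous_on U F"
| "Ck_on (Suc k) F U \<longleftrightarrow>
     (\<forall>x\<in>U. F differentiable (at x)) \<and> (\<forall>v. Ck_on k (\<lambda>x. frechet_derivative F (at x) v) U)"

text \<open>Smoothness on an arbitrary subset means the existence of local smooth extensions. For open
  sets this is ordinary smoothness.\<close>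

definition smooth_map_on :: "'a::euclidean_space set \<Rightarrow> ('a \<Rightarrow> 'b::euclidean_space) \<Rightarrow> bool" where
  "smooth_map_on S F \<longleftrightarrow>
     (\<forall>x\<in>S. \<exists>U G. open U \<and> x \<in> U \<and> (\<forall>k. Ck_on k G U) \<and> (\<forall>y\<in>S \<inter> U. F y = G y))"

definition tangent_space :: "'a::euclidean_space set \<Rightarrow> 'a \<Rightarrow> 'a set" where
  "tangent_space S x =
     {v. \<exists>\<epsilon>>0. \<exists>\<gamma>::real \<Rightarrow> 'a. smooth_map_on {-\<epsilon><..<\<epsilon>} \<gamma> \<and> \<gamma> ` {-\<epsilon><..<\<epsilon>} \<subseteq> S \<and>
           \<gamma> 0 = x \<and> (\<gamma> has_vector_derivative v) (at 0)}"

text \<open>The differential of a map on a submanifold \<open>S\<close>. The Frechet derivative within \<open>S\<close> is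
  not unique as a linear map on the ambient space, but its values on \<open>tangent_space S x\<close> are;
  it is only ever applied to such vectors.\<close>

definition differential ::
    "'a::euclidean_space set \<Rightarrow> ('a \<Rightarrow> 'b::euclidean_space) \<Rightarrow> 'a \<Rightarrow> 'a \<Rightarrow> 'b" where
  "differential S F x v = frechet_derivative F (at x within S) v"

definition S3 :: "(real^4) set" where
  "S3 = sphere 0 1"


section \<open>The homogeneous space \<open>O(4)/O(3)\<close> and the maps \<open>\<Gamma>\<^sub>p\<close>\<close>

definition e1 :: "real^4" where
  "e1 = axis 1 1"

definition O4 :: "(real^4^4) set" where
  "O4 = {x. orthogonal_matrix x}"

definition O3 :: "(real^4^4) set" where
  "O3 = {x \<in> O4. x *v e1 = e1}"

definition lie_inner :: "real^4^4 \<Rightarrow> real^4^4 \<Rightarrow> real" where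
  "lie_inner u v = trace (u ** transpose v) / 2"

definition metric_O4 :: "real^4^4 \<Rightarrow> real^4^4 \<Rightarrow> real^4^4 \<Rightarrow> real" where
  "metric_O4 x u v = lie_inner (matrix_inv x ** u) (matrix_inv x ** v)"

definition proj_S3 :: "real^4^4 \<Rightarrow> real^4" where
  "proj_S3 x = x *v e1"

definition horizontal :: "real^4^4 \<Rightarrow> (real^4^4) set" where
  "horizontal x =
     {h \<in> tangent_space O4 x. \<forall>v\<in>tangent_space ((\<lambda>y. x ** y) ` O3) x. metric_O4 x h v = 0}"

definition ell_inv :: "real^4^4 \<Rightarrow> real^4 \<Rightarrow> real^4^4" where
  "ell_inv x u = inv_into (horizontal x) (differential O4 proj_S3 x) u"

definition Gamma :: "real^4 \<Rightarrow> real^4 \<Rightarrow> real^4^4" where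
  "Gamma p u =
     (let x = (SOME x. x \<in> O4 \<and> proj_S3 x = p)
      in differential O4 (\<lambda>z. z ** matrix_inv x) x (ell_inv x u))"


section \<open>Abstract smooth surfaces\<close>

type_synonym 'm chart = "'m set \<times> ('m \<Rightarrow> real^2)"

definition charts_at :: "'m chart set \<Rightarrow> 'm \<Rightarrow> 'm chart set" where
  "charts_at A p = {c \<in> A. p \<in> fst c}"

definition in_chart :: "'m chart \<Rightarrow> ('m \<Rightarrow> 'b) \<Rightarrow> real^2 \<Rightarrow> 'b" where
  "in_chart c F = F \<circ> inv_into (fst c) (snd c)"

definition smooth_atlas :: "'m topology \<Rightarrow> 'm chart set \<Rightarrow> bool" where
  "smooth_atlas M A \<longleftrightarrow>
     (\<Union>c\<in>A. fst c) = topspace M \<and>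
     (\<forall>c\<in>A. openin M (fst c) \<and> open (snd c ` fst c) \<and>
        homeomorphic_map (subtopology M (fst c)) (top_of_set (snd c ` fst c)) (snd c)) \<and>
     (\<forall>c\<in>A. \<forall>c'\<in>A. smooth_map_on (snd c ` (fst c \<inter> fst c')) (in_chart c (snd c')))"

definition smooth_surface :: "'m topology \<Rightarrow> 'm chart set \<Rightarrow> bool" where
  "smooth_surface M A \<longleftrightarrow> Hausdorff_space M \<and> second_countable M \<and> smooth_atlas M A"

definition orientable_surface :: "'m topology \<Rightarrow> 'm chart set \<Rightarrow> bool" where
  "orientable_surface M A \<longleftrightarrow> smooth_surface M A \<and>
     (\<exists>B. smooth_atlas M (A \<union> B) \<and> (\<Union>c\<in>B. fst c) = topspace M \<and>
        (\<forall>c\<in>B. \<forall>c'\<in>B. \<forall>p\<in>fst c \<inter> fst c'.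
           det (matrix (frechet_derivative (in_chart c (snd c')) (at (snd c p)))) > 0))"

text \<open>A tangent vector is the family of its coordinate vectors in the charts around \<open>p\<close>, related
  by the differentials of the transition maps; it is set to \<open>0\<close> outside these charts.\<close>

definition tangent_vectors :: "'m chart set \<Rightarrow> 'm \<Rightarrow> ('m chart \<Rightarrow> real^2) set" where
  "tangent_vectors A p =
     {X. (\<forall>c\<in>charts_at A p. \<forall>c'\<in>charts_at A p.
            X c' = frechet_derivative (in_chart c (snd c')) (at (snd c p)) (X c)) \<and>
         (\<forall>c. c \<notin> charts_at A p \<longrightarrow> X c = 0)}"

definition smooth_on_surface :: "'m chart set \<Rightarrow> ('m \<Rightarrow> 'b::euclidean_space) \<Rightarrow> bool" where
  "smooth_on_surface A F \<longleftrightarrow> (\<forall>c\<in>A. smooth_map_on (snd c ` fst c) (in_chart c F))"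

text \<open>By the chain rule the value does not depend on the chosen chart.\<close>

definition surface_differential ::
    "'m chart set \<Rightarrow> ('m \<Rightarrow> 'b::euclidean_space) \<Rightarrow> 'm \<Rightarrow> ('m chart \<Rightarrow> real^2) \<Rightarrow> 'b" where
  "surface_differential A F p X =
     (let c = (SOME c. c \<in> charts_at A p)
      in frechet_derivative (in_chart c F) (at (snd c p)) (X c))"

definition immersion_into ::
    "'m topology \<Rightarrow> 'm chart set \<Rightarrow> ('m \<Rightarrow> 'b::euclidean_space) \<Rightarrow> 'b set \<Rightarrow> bool" where
  "immersion_into M A f S \<longleftrightarrow>
     smooth_on_surface A f \<and> f ` topspace M \<subseteq> S \<and>
     (\<forall>p\<in>topspace M. inj_on (surface_differential A f p) (tangent_vectors A p))"

definition fields_along ::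
    "'m topology \<Rightarrow> 'm chart set \<Rightarrow> ('m \<Rightarrow> 'b::euclidean_space) \<Rightarrow> 'b set \<Rightarrow> ('m \<Rightarrow> 'b) set" where
  "fields_along M A f S =
     {\<xi>. smooth_on_surface A \<xi> \<and> (\<forall>p\<in>topspace M. \<xi> p \<in> tangent_space S (f p))}"

definition unit_normal_field ::
    "'m topology \<Rightarrow> 'm chart set \<Rightarrow> ('m \<Rightarrow> real^4) \<Rightarrow> ('m \<Rightarrow> real^4) \<Rightarrow> bool" where
  "unit_normal_field M A f \<eta> \<longleftrightarrow>
     \<eta> \<in> fields_along M A f S3 \<and>
     (\<forall>p\<in>topspace M. norm (\<eta> p) = 1 \<and>
        (\<forall>X\<in>tangent_vectors A p. \<eta> p \<bullet> surface_differential A f p X = 0))"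

definition gauss_map :: "('m \<Rightarrow> real^4) \<Rightarrow> ('m \<Rightarrow> real^4) \<Rightarrow> 'm \<Rightarrow> real^4^4" where
  "gauss_map f \<eta> p = Gamma (f p) (\<eta> p)"


section \<open>The Levi-Civita connection and the shape operator\<close>

text \<open>Functions and vector fields on \<open>S\<close> are represented by functions on the ambient space; only
  their values on \<open>S\<close> matter.\<close>

definition vector_fields :: "'a::euclidean_space set \<Rightarrow> ('a \<Rightarrow> 'a) set" where
  "vector_fields S = {V. smooth_map_on S V \<and> (\<forall>x\<in>S. V x \<in> tangent_space S x)}"

definition field_derivative ::
    "'a::euclidean_space set \<Rightarrow> ('a \<Rightarrow> 'a) \<Rightarrow> ('a \<Rightarrow> real) \<Rightarrow> 'a \<Rightarrow> real" where
  "field_derivative S V g x = differential S g x (V x)"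

definition affine_connection ::
    "'a::euclidean_space set \<Rightarrow> (('a \<Rightarrow> 'a) \<Rightarrow> ('a \<Rightarrow> 'a) \<Rightarrow> 'a \<Rightarrow> 'a) \<Rightarrow> bool" where
  "affine_connection S D \<longleftrightarrow>
     (\<forall>V\<in>vector_fields S. \<forall>W\<in>vector_fields S. D V W \<in> vector_fields S) \<and>
     (\<forall>V\<in>vector_fields S. \<forall>V'\<in>vector_fields S. \<forall>W\<in>vector_fields S. \<forall>g h. \<forall>x\<in>S.
        smooth_map_on S g \<longrightarrow> smooth_map_on S h \<longrightarrow>
        D (\<lambda>y. g y *\<^sub>R V y + h y *\<^sub>R V' y) W x = g x *\<^sub>R D V W x + h x *\<^sub>R D V' W x) \<and>
     (\<forall>V\<in>vector_fields S. \<forall>W\<in>vector_fields S. \<forall>W'\<in>vector_fields S. \<forall>x\<in>S.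
        D V (\<lambda>y. W y + W' y) x = D V W x + D V W' x) \<and>
     (\<forall>V\<in>vector_fields S. \<forall>W\<in>vector_fields S. \<forall>g. \<forall>x\<in>S. smooth_map_on S g \<longrightarrow>
        D V (\<lambda>y. g y *\<^sub>R W y) x = field_derivative S V g x *\<^sub>R W x + g x *\<^sub>R D V W x)"

text \<open>The Riemannian metric on \<open>S\<close> is the one induced by the ambient inner product. Vanishing of
  the torsion, \<open>D\<^sub>V W - D\<^sub>W V = [V, W]\<close>, is expressed by the action on smooth functions.\<close>

definition levi_civita_connection ::
    "'a::euclidean_space set \<Rightarrow> (('a \<Rightarrow> 'a) \<Rightarrow> ('a \<Rightarrow> 'a) \<Rightarrow> 'a \<Rightarrow> 'a) \<Rightarrow> bool" where
  "levi_civita_connection S D \<longleftrightarrow> affine_connection S D \<and>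
     (\<forall>V\<in>vector_fields S. \<forall>W\<in>vector_fields S. \<forall>g. \<forall>x\<in>S. smooth_map_on S g \<longrightarrow>
        differential S g x (D V W x - D W V x) =
          field_derivative S V (field_derivative S W g) x
          - field_derivative S W (field_derivative S V g) x) \<and>
     (\<forall>V\<in>vector_fields S. \<forall>W\<in>vector_fields S. \<forall>Z\<in>vector_fields S. \<forall>x\<in>S.
        field_derivative S V (\<lambda>y. W y \<bullet> Z y) x = D V W x \<bullet> Z x + W x \<bullet> D V Z x)"

text \<open>For an immersed surface, the covariant derivative of a vector field along \<open>f\<close>, such as a
  unit normal field, is the one induced (pulled back) from the connection \<open>D\<close> of \<open>S\<close>: it obeys the
  Leibniz rule and agrees with \<open>D\<close> on fields that are restrictions \<open>W \<circ> f\<close> of fields on \<open>S\<close>.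
  These properties determine \<open>nab p X \<xi>\<close>.\<close>

definition induced_connection ::
    "'m topology \<Rightarrow> 'm chart set \<Rightarrow> ('m \<Rightarrow> 'b::euclidean_space) \<Rightarrow> 'b set \<Rightarrow>
     (('b \<Rightarrow> 'b) \<Rightarrow> ('b \<Rightarrow> 'b) \<Rightarrow> 'b \<Rightarrow> 'b) \<Rightarrow>
     ('m \<Rightarrow> ('m chart \<Rightarrow> real^2) \<Rightarrow> ('m \<Rightarrow> 'b) \<Rightarrow> 'b) \<Rightarrow> bool" where
  "induced_connection M A f S D nab \<longleftrightarrow>
     (\<forall>p\<in>topspace M. \<forall>X\<in>tangent_vectors A p.
        (\<forall>\<xi>\<in>fields_along M A f S. nab p X \<xi> \<in> tangent_space S (f p)) \<and>
        (\<forall>\<xi>\<in>fields_along M A f S. \<forall>X'\<in>tangent_vectors A p. \<forall>a b.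
           nab p (\<lambda>c. a *\<^sub>R X c + b *\<^sub>R X' c) \<xi> = a *\<^sub>R nab p X \<xi> + b *\<^sub>R nab p X' \<xi>) \<and>
        (\<forall>\<xi>\<in>fields_along M A f S. \<forall>\<zeta>\<in>fields_along M A f S.
           nab p X (\<lambda>q. \<xi> q + \<zeta> q) = nab p X \<xi> + nab p X \<zeta>) \<and>
        (\<forall>\<xi>\<in>fields_along M A f S. \<forall>g. smooth_on_surface A g \<longrightarrow>
           nab p X (\<lambda>q. g q *\<^sub>R \<xi> q) = surface_differential A g p X *\<^sub>R \<xi> p + g p *\<^sub>R nab p X \<xi>) \<and>
        (\<forall>V\<in>vector_fields S. \<forall>W\<in>vector_fields S. V (f p) = surface_differential A f p X \<longrightarrow>
           nab p X (\<lambda>q. W (f q)) = D V W (f p)))"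

text \<open>Tangent vectors of the surface are identified with their images under the differential of
  the immersion, so the shape operator takes values in the tangent space of \<open>S3\<close>.\<close>

definition shape_operator ::
    "('m \<Rightarrow> ('m chart \<Rightarrow> real^2) \<Rightarrow> ('m \<Rightarrow> real^4) \<Rightarrow> real^4) \<Rightarrow> ('m \<Rightarrow> real^4) \<Rightarrow>
     'm \<Rightarrow> ('m chart \<Rightarrow> real^2) \<Rightarrow> real^4" where
  "shape_operator nab \<eta> p X = - nab p X \<eta>"

end

theory Submission
  imports Defs
begin

text \<open>Write \<open>u \<and> v\<close> for the skew-symmetric matrix \<open>u v\<^sup>T - v u\<^sup>T\<close>. Everything rests on the
  formula \<open>\<Gamma>\<^sub>p(u) = u \<and> p\<close> for \<open>u\<close> orthogonal to \<open>p\<close> (\<open>Gamma_eq_wedge\<close>): the horizontal lift of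
  \<open>u\<close> at \<open>x\<close> with \<open>x e\<^sub>1 = p\<close> is \<open>x (x\<^sup>T u \<and> e\<^sub>1)\<close>, and right translation by \<open>x\<^sup>T\<close> turns it into
  \<open>u \<and> x e\<^sub>1\<close>. Hence the Gauss map is \<open>\<eta> \<and> f\<close> and, by the product rule,
  \<open>d\<N>(X) = \<eta> \<and> df(X) + d\<eta>(X) \<and> f\<close>. Pairing with \<open>df(Y) \<and> f\<close> by means of
  \<open>\<langle>a \<and> b, c \<and> d\<rangle> = (a\<bullet>c)(b\<bullet>d) - (a\<bullet>d)(b\<bullet>c)\<close>, all terms but one vanish, because \<open>\<eta>\<close> and the
  tangent vectors \<open>df(X)\<close>, \<open>df(Y)\<close> are orthogonal to \<open>f\<close> and \<open>|f| = 1\<close>; what remains is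
  \<open>d\<eta>(X) \<bullet> df(Y)\<close>.

  It remains to see that the induced connection is the tangential part of the ordinary derivative,
  that is \<open>\<nabla>\<^sub>X \<eta> \<bullet> w = d\<eta>(X) \<bullet> w\<close> for all \<open>w\<close> tangent to the sphere
  (\<open>induced_connection_unit_sphere\<close>). The connections are only given by their axioms, which speak
  about globally defined fields. Convenient global fields are the infinitesimal rotations
  \<open>x \<mapsto> L x\<close> with \<open>L\<close> skew: they span every tangent space, and on them the uniqueness argument for
  the Levi-Civita connection becomes linear algebra (\<open>levi_civita_skew_linear\<close>). A field along
  the surface is a combination of infinitesimal rotations with smooth coefficients that are given
  by an explicit formula (\<open>rotation_generator_expansion\<close>), so the Leibniz rule carries the result
  over to it.\<close>

section \<open>Smooth maps\<close>

lemma Ck_on_cong: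
  assumes "open U" "\<forall>x\<in>U. F x = G x" "Ck_on k F U"
  shows "Ck_on k G U"
  using assms(2,3)
proof (induction k arbitrary: F G)
  case 0
  then show ?case by (metis Ck_on.simps(1) continuous_on_cong)
next
  case (Suc k)
  have der: "(G has_derivative frechet_derivative F (at x)) (at x)" if "x \<in> U" for x
    using Suc.prems that assms(1)
    by (metis Ck_on.simps(2) frechet_derivative_works has_derivative_transform_within_open)
  then have eq: "frechet_derivative F (at x) = frechet_derivative G (at x)" if "x \<in> U" for x
    using frechet_derivative_at that by blast
  have "Ck_on k (\<lambda>x. frechet_derivative G (at x) v) U" for v
    by (rule Suc.IH[of "\<lambda>x. frechet_derivative F (at x) v"]) (use Suc.prems eq in auto)
  then show ?case using der by (auto intro: differentiableI)
qed

lemma Ck_on_subset: "Ck_on k F U \<Longrightarrow> V \<subseteq> U \<Longrightarrow> Ck_on k F V"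
  by (induction k arbitrary: F) (auto intro: continuous_on_subset)

lemma Ck_on_SucD: "Ck_on (Suc k) F U \<Longrightarrow> Ck_on k F U"
proof (induction k arbitrary: F)
  case 0
  then show ?case
    by (auto intro!: continuous_at_imp_continuous_on differentiable_imp_continuous_within)
next
  case (Suc k)
  then show ?case by (metis Ck_on.simps(2))
qed

text \<open>The derivative may be exhibited in any form, since on an open set it is unique.\<close>

lemma Ck_on_SucI:
  assumes "open U" "\<And>x. x \<in> U \<Longrightarrow> (F has_derivative F' x) (at x)" "\<And>v. Ck_on k (\<lambda>x. F' x v) U"
  shows "Ck_on (Suc k) F U"
proof -
  have "Ck_on k (\<lambda>x. frechet_derivative F (at x) v) U" for v
    by (rule Ck_on_cong[OF assms(1) _ assms(3)[of v]])
       (simp add: frechet_derivative_at[OF assms(2), symmetric])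
  then show ?thesis using assms(2) by (auto intro: differentiableI)
qed

lemma Ck_on_SucE:
  assumes "Ck_on (Suc k) F U" "x \<in> U"
  shows "(F has_derivative frechet_derivative F (at x)) (at x)"
  using assms by (simp add: frechet_derivative_works[symmetric])

lemma Ck_on_const: "open U \<Longrightarrow> Ck_on k (\<lambda>x. c) U"
proof (induction k arbitrary: c)
  case (Suc k)
  show ?case
    by (rule Ck_on_SucI[of _ _ "\<lambda>_ _. 0", OF Suc.prems has_derivative_const Suc.IH[OF Suc.prems]])
qed simp

lemma Ck_on_linear:
  assumes "bounded_linear L" "open U" shows "Ck_on k L U"
proof (cases k)
  case (Suc m)
  show ?thesis unfolding Suc
    by (rule Ck_on_SucI[of _ _ "\<lambda>_. L", OF assms(2)
          bounded_linear_imp_has_derivative[OF assms(1)] Ck_on_const[OF assms(2)]])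
qed (use assms linear_continuous_on in auto)

lemma Ck_on_add:
  assumes "open U" "Ck_on k F U" "Ck_on k G U" shows "Ck_on k (\<lambda>x. F x + G x) U"
  using assms(2,3)
proof (induction k arbitrary: F G)
  case (Suc k)
  note der = Ck_on_SucE[OF Suc.prems(1)] Ck_on_SucE[OF Suc.prems(2)]
  show ?case
    by (rule Ck_on_SucI[OF assms(1) has_derivative_add[OF der] Suc.IH])
       (use Suc.prems in simp_all)
qed (auto intro!: continuous_on_add)

lemma Ck_on_bilinear:
  assumes "bounded_bilinear B" "open U" "Ck_on k F U" "Ck_on k G U"
  shows "Ck_on k (\<lambda>x. B (F x) (G x)) U"
  using assms(3,4)
proof (induction k arbitrary: F G)
  case 0
  then show ?case using bounded_bilinear.continuous_on[OF assms(1)] by auto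
next
  case (Suc k)
  note der = Ck_on_SucE[OF Suc.prems(1)] Ck_on_SucE[OF Suc.prems(2)]
  show ?case
    by (rule Ck_on_SucI[OF assms(2) bounded_bilinear.FDERIV[OF assms(1) der]
          Ck_on_add[OF assms(2) Suc.IH Suc.IH]])
       (use Suc.prems Ck_on_SucD[OF Suc.prems(1)] Ck_on_SucD[OF Suc.prems(2)] in simp_all)
qed

lemma Ck_on_linear_compose:
  assumes "bounded_linear L" "open U" "Ck_on k F U"
  shows "Ck_on k (\<lambda>x. L (F x)) U"
  using assms(3)
proof (induction k arbitrary: F)
  case 0
  then show ?case using bounded_linear.continuous_on[OF assms(1)] by auto
next
  case (Suc k)
  show ?case
    by (rule Ck_on_SucI[OF assms(2)
          bounded_linear.has_derivative[OF assms(1) Ck_on_SucE[OF Suc.prems]] Suc.IH])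
       (use Suc.prems in simp_all)
qed

text \<open>The constants \<open>c\<close>, \<open>x\<close>, \<open>y\<close> are arbitrary so that the family is closed under differentiation,
  which is what the induction needs. Both great circles and one-parameter groups of plane rotations
  are of this form.\<close>

lemma Ck_on_trig:
  assumes "open U"
  shows "Ck_on k (\<lambda>t::real. c + cos (a * t) *\<^sub>R x + sin (a * t) *\<^sub>R y) U"
proof (induction k arbitrary: c x y)
  case 0
  show ?case by (intro Ck_on.simps(1)[THEN iffD2] continuous_intros)
next
  case (Suc k)
  show ?case
  proof (rule Ck_on_SucI[OF assms])
    show "((\<lambda>t. c + cos (a * t) *\<^sub>R x + sin (a * t) *\<^sub>R y) has_derivative
       (\<lambda>h. 0 + cos (a * t) *\<^sub>R ((h * a) *\<^sub>R y) + sin (a * t) *\<^sub>R (- (h * a) *\<^sub>R x))) (at t)" for t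
      by (auto intro!: derivative_eq_intros simp: algebra_simps)
  qed (rule Suc)
qed

lemma smooth_map_onI:
  assumes "open U" "S \<subseteq> U" "\<And>k. Ck_on k F U" shows "smooth_map_on S F"
  using assms unfolding smooth_map_on_def by blast

lemma smooth_map_onE:
  assumes "smooth_map_on S F" "x \<in> S"
  obtains U G where "open U" "x \<in> U" "\<And>k. Ck_on k G U" "\<And>y. y \<in> S \<Longrightarrow> y \<in> U \<Longrightarrow> F y = G y"
proof -
  from bspec[OF assms(1)[unfolded smooth_map_on_def] assms(2)]
  show thesis by (elim exE conjE) (rule that, assumption, assumption, erule spec, auto)
qed

lemma smooth_map_on_cong:
  assumes "smooth_map_on S F" "\<And>x. x \<in> S \<Longrightarrow> F x = G x" shows "smooth_map_on S G"
  using assms unfolding smooth_map_on_def by (metis IntD1)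

lemma smooth_map_on_add:
  assumes "smooth_map_on S F" "smooth_map_on S G" shows "smooth_map_on S (\<lambda>x. F x + G x)"
  unfolding smooth_map_on_def
proof
  fix x assume "x \<in> S"
  obtain U F' where F': "open U" "x \<in> U" "\<And>k. Ck_on k F' U"
      "\<And>y. y \<in> S \<Longrightarrow> y \<in> U \<Longrightarrow> F y = F' y"
    using smooth_map_onE[OF assms(1) \<open>x \<in> S\<close>] by metis
  obtain V G' where G': "open V" "x \<in> V" "\<And>k. Ck_on k G' V"
      "\<And>y. y \<in> S \<Longrightarrow> y \<in> V \<Longrightarrow> G y = G' y"
    using smooth_map_onE[OF assms(2) \<open>x \<in> S\<close>] by metis
  have "Ck_on k (\<lambda>x. F' x + G' x) (U \<inter> V)" for k
    by (intro Ck_on_add open_Int Ck_on_subset[OF F'(3)] Ck_on_subset[OF G'(3)] F' G') auto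
  then show "\<exists>U H. open U \<and> x \<in> U \<and> (\<forall>k. Ck_on k H U) \<and> (\<forall>y\<in>S \<inter> U. F y + G y = H y)"
    by (intro exI[of _ "U \<inter> V"] exI[of _ "\<lambda>x. F' x + G' x"]) (use F' G' in auto)
qed

lemma smooth_map_on_bilinear:
  assumes "bounded_bilinear B" "smooth_map_on S F" "smooth_map_on S G"
  shows "smooth_map_on S (\<lambda>x. B (F x) (G x))"
  unfolding smooth_map_on_def
proof
  fix x assume "x \<in> S"
  obtain U F' where F': "open U" "x \<in> U" "\<And>k. Ck_on k F' U"
      "\<And>y. y \<in> S \<Longrightarrow> y \<in> U \<Longrightarrow> F y = F' y"
    using smooth_map_onE[OF assms(2) \<open>x \<in> S\<close>] by metis
  obtain V G' where G': "open V" "x \<in> V" "\<And>k. Ck_on k G' V"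
      "\<And>y. y \<in> S \<Longrightarrow> y \<in> V \<Longrightarrow> G y = G' y"
    using smooth_map_onE[OF assms(3) \<open>x \<in> S\<close>] by metis
  have "Ck_on k (\<lambda>x. B (F' x) (G' x)) (U \<inter> V)" for k
    by (intro Ck_on_bilinear[OF assms(1)] open_Int Ck_on_subset[OF F'(3)] Ck_on_subset[OF G'(3)] F' G') auto
  then show "\<exists>U H. open U \<and> x \<in> U \<and> (\<forall>k. Ck_on k H U) \<and> (\<forall>y\<in>S \<inter> U. B (F y) (G y) = H y)"
    by (intro exI[of _ "U \<inter> V"] exI[of _ "\<lambda>x. B (F' x) (G' x)"]) (use F' G' in auto)
qed

lemma smooth_map_on_linear_compose:
  assumes "bounded_linear L" "smooth_map_on S F"
  shows "smooth_map_on S (\<lambda>x. L (F x))"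
  unfolding smooth_map_on_def
proof
  fix x assume "x \<in> S"
  obtain U F' where F': "open U" "x \<in> U" "\<And>k. Ck_on k F' U"
      "\<And>y. y \<in> S \<Longrightarrow> y \<in> U \<Longrightarrow> F y = F' y"
    using smooth_map_onE[OF assms(2) \<open>x \<in> S\<close>] by metis
  then show "\<exists>U H. open U \<and> x \<in> U \<and> (\<forall>k. Ck_on k H U) \<and> (\<forall>y\<in>S \<inter> U. L (F y) = H y)"
    by (intro exI[of _ U] exI[of _ "\<lambda>x. L (F' x)"])
       (auto intro!: Ck_on_linear_compose[OF assms(1)])
qed

lemma smooth_map_on_const: "smooth_map_on S (\<lambda>x. c)"
  by (rule smooth_map_onI[of UNIV]) (auto intro: Ck_on_const)

lemma smooth_map_on_linear: "bounded_linear L \<Longrightarrow> smooth_map_on S L"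
  by (rule smooth_map_onI[of UNIV]) (auto intro: Ck_on_linear)

lemma smooth_map_on_open_differentiable:
  assumes "smooth_map_on U F" "open U" "x \<in> U" shows "F differentiable at x"
proof -
  obtain V G where G: "open V" "x \<in> V" "\<And>k. Ck_on k G V"
      "\<And>y. y \<in> U \<Longrightarrow> y \<in> V \<Longrightarrow> F y = G y"
    using smooth_map_onE[OF assms(1,3)] by metis
  have "Ck_on (Suc 0) F (U \<inter> V)"
    by (rule Ck_on_cong[of _ G, OF _ _ Ck_on_subset[OF G(3)]]) (use assms(2) G in auto)
  then show ?thesis using assms \<open>x \<in> V\<close> by auto
qed


section \<open>Differentials and tangent spaces of subsets of Euclidean space\<close>

text \<open>Two derivatives within \<open>S\<close> may differ as linear maps, but along a curve in \<open>S\<close> both compute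
  the velocity of the image curve.\<close>

lemma differential_eq:
  assumes "(F has_derivative F') (at x within S)" "v \<in> tangent_space S x"
  shows "differential S F x v = F' v"
proof -
  obtain e and \<gamma> :: "real \<Rightarrow> 'a" where e: "e > 0" "\<gamma> ` {-e<..<e} \<subseteq> S" "\<gamma> 0 = x"
    and g: "(\<gamma> has_vector_derivative v) (at 0)"
    using assms(2) unfolding tangent_space_def by blast
  have *: "((\<lambda>t. F (\<gamma> t)) has_vector_derivative T v) (at 0)"
    if T: "(F has_derivative T) (at x within S)" for T
  proof -
    have "((\<lambda>t. F (\<gamma> t)) has_derivative (\<lambda>h. T (h *\<^sub>R v))) (at 0 within {-e<..<e})"
      by (rule has_derivative_in_compose)
         (use g e has_derivative_subset[OF T e(2)] in
           \<open>auto simp: has_vector_derivative_def intro: has_derivative_at_withinI\<close>)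
    moreover have "T (h *\<^sub>R v) = h *\<^sub>R T v" for h
      using has_derivative_linear[OF T] linear_scale by blast
    moreover have "at 0 within {-e<..<e} = at (0::real)"
      using e(1) by (intro at_within_open) auto
    ultimately show ?thesis by (simp add: has_vector_derivative_def)
  qed
  have "(F has_derivative frechet_derivative F (at x within S)) (at x within S)"
    using assms(1) differentiable_def frechet_derivative_works by blast
  from vector_derivative_unique_at[OF *[OF this] *[OF assms(1)]]
  show ?thesis by (simp add: differential_def)
qed

lemma differential_linear_on:
  assumes "bounded_linear L" "x \<in> S" "\<And>y. y \<in> S \<Longrightarrow> F y = L y" "v \<in> tangent_space S x"
  shows "differential S F x v = L v"
  by (rule differential_eq[OF has_derivative_transform assms(4)])
     (use assms bounded_linear_imp_has_derivative in auto)

lemma tangent_space_mono: "S \<subseteq> T \<Longrightarrow> tangent_space S x \<subseteq> tangent_space T x"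
  unfolding tangent_space_def by blast

text \<open>How elements of tangent spaces are exhibited.\<close>

lemma trig_velocity_in_tangent_space:
  assumes "\<And>t. c + cos (a * t) *\<^sub>R x + sin (a * t) *\<^sub>R y \<in> S"
  shows "a *\<^sub>R y \<in> tangent_space S (c + x)"
proof -
  let ?g = "\<lambda>t::real. c + cos (a * t) *\<^sub>R x + sin (a * t) *\<^sub>R y"
  have "(?g has_vector_derivative a *\<^sub>R y) (at 0)"
    by (auto intro!: derivative_eq_intros simp: has_vector_derivative_def algebra_simps)
  moreover have "smooth_map_on {-1<..<1} ?g"
    by (rule smooth_map_onI[of UNIV]) (auto intro: Ck_on_trig)
  ultimately show ?thesis unfolding tangent_space_def using assms
    by (intro CollectI exI[of _ 1] exI[of _ ?g]) auto
qed

text \<open>How upper bounds on tangent spaces are obtained: differentiate an equation satisfied on \<open>S\<close>.\<close>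

lemma tangent_constraint:
  fixes F :: "'a::euclidean_space \<Rightarrow> 'b::euclidean_space"
  assumes "v \<in> tangent_space S x" "(F has_derivative F') (at x)" "\<And>y. y \<in> S \<Longrightarrow> F y = c" "x \<in> S"
  shows "F' v = 0"
proof -
  have "differential S F x v = F' v"
    using assms(1,2) by (blast intro: differential_eq has_derivative_at_withinI)
  moreover have "differential S F x v = 0"
    by (rule differential_eq[OF has_derivative_transform[of _ _ _ "\<lambda>_. c"] assms(1)])
       (use assms in auto)
  ultimately show ?thesis by simp
qed

text \<open>One inclusion differentiates \<open>y \<bullet> y = 1\<close>; for the other, \<open>v\<close> is the initial velocity of a
  great circle.\<close>

lemma tangent_space_unit_sphere:
  fixes x :: "'a::euclidean_space"
  assumes "x \<in> sphere 0 1"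
  shows "tangent_space (sphere 0 1) x = {v. x \<bullet> v = 0}"
proof (intro set_eqI iffI)
  fix v assume v: "v \<in> tangent_space (sphere 0 1) x"
  have "(\<lambda>h. x \<bullet> h + h \<bullet> x) v = 0"
    by (rule tangent_constraint[OF v, where F = "\<lambda>y. y \<bullet> y" and c = 1])
       (use assms in \<open>auto intro!: derivative_eq_intros simp: norm_eq_1\<close>)
  then show "v \<in> {v. x \<bullet> v = 0}" by (simp add: inner_commute)
next
  fix v assume "v \<in> {v. x \<bullet> v = 0}"
  then have v: "x \<bullet> v = 0" by simp
  show "v \<in> tangent_space (sphere 0 1) x"
  proof -
    define y where "y = sgn v"
    have y: "norm v *\<^sub>R y = v" by (cases "v = 0") (auto simp: y_def sgn_div_norm)
    have xy: "x \<bullet> y = 0" using v by (simp add: y_def sgn_div_norm)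
    have xx: "x \<bullet> x = 1" using assms by (simp add: norm_eq_1)
    have "norm (0 + cos (norm v * t) *\<^sub>R x + sin (norm v * t) *\<^sub>R y) = 1" for t
    proof (cases "v = 0")
      case False
      then have yy: "y \<bullet> y = 1" by (metis norm_eq_1 norm_sgn y_def)
      show ?thesis
        unfolding norm_eq_1 using xx xy yy
        by (simp add: inner_add inner_commute[of y x] flip: power2_eq_square)
    qed (use assms in simp)
    then have "norm v *\<^sub>R y \<in> tangent_space (sphere 0 1) (0 + x)"
      by (intro trig_velocity_in_tangent_space) auto
    then show ?thesis using y by simp
  qed
qed

section \<open>Differential calculus on an abstract surface\<close>

text \<open>The chart in which \<^const>\<open>surface_differential\<close> is computed.\<close>

definition chart_at :: "'m chart set \<Rightarrow> 'm \<Rightarrow> 'm chart" where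
  "chart_at A p = (SOME c. c \<in> charts_at A p)"

lemma chart_at_contains:
  assumes "smooth_atlas M A" "p \<in> topspace M"
  shows "chart_at A p \<in> A" "p \<in> fst (chart_at A p)"
proof -
  have "\<exists>c. c \<in> charts_at A p" using assms unfolding smooth_atlas_def charts_at_def by blast
  then have "chart_at A p \<in> charts_at A p" unfolding chart_at_def by (rule someI_ex)
  then show "chart_at A p \<in> A" "p \<in> fst (chart_at A p)" by (auto simp: charts_at_def)
qed

lemma chart_domain:
  assumes "smooth_atlas M A" "c \<in> A"
  shows "fst c \<subseteq> topspace M" "open (snd c ` fst c)" "inj_on (snd c) (fst c)"
proof -
  show sub: "fst c \<subseteq> topspace M" using assms unfolding smooth_atlas_def by blast
  show "open (snd c ` fst c)" using assms unfolding smooth_atlas_def by blast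
  have "homeomorphic_map (subtopology M (fst c)) (top_of_set (snd c ` fst c)) (snd c)"
    using assms unfolding smooth_atlas_def by blast
  from homeomorphic_imp_injective_map[OF this] show "inj_on (snd c) (fst c)"
    using sub by (simp add: Int_absorb1)
qed

lemma smooth_on_surface_cong:
  assumes "smooth_atlas M A" "smooth_on_surface A F" "\<And>q. q \<in> topspace M \<Longrightarrow> F q = G q"
  shows "smooth_on_surface A G"
  unfolding smooth_on_surface_def
proof
  fix c assume c: "c \<in> A"
  then have "smooth_map_on (snd c ` fst c) (in_chart c F)"
    using assms(2) by (simp add: smooth_on_surface_def)
  then show "smooth_map_on (snd c ` fst c) (in_chart c G)"
  proof (rule smooth_map_on_cong)
    fix z assume "z \<in> snd c ` fst c"
    then have "inv_into (fst c) (snd c) z \<in> topspace M"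
      using chart_domain(1)[OF assms(1) c] by (metis inv_into_into subsetD)
    then show "in_chart c F z = in_chart c G z" using assms(3) by (simp add: in_chart_def)
  qed
qed

lemma smooth_on_surface_bilinear:
  assumes "bounded_bilinear B" "smooth_on_surface A F" "smooth_on_surface A G"
  shows "smooth_on_surface A (\<lambda>q. B (F q) (G q))"
  using assms smooth_map_on_bilinear[OF assms(1)]
  by (fastforce simp: smooth_on_surface_def in_chart_def comp_def)

lemma smooth_on_surface_linear:
  assumes "bounded_linear L" "smooth_on_surface A F"
  shows "smooth_on_surface A (\<lambda>q. L (F q))"
  using assms smooth_map_on_linear_compose[OF assms(1)]
  by (fastforce simp: smooth_on_surface_def in_chart_def comp_def)

lemma smooth_on_surface_add:
  assumes "smooth_on_surface A F" "smooth_on_surface A G"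
  shows "smooth_on_surface A (\<lambda>q. F q + G q)"
  using assms smooth_map_on_add
  by (fastforce simp: smooth_on_surface_def in_chart_def comp_def)

lemma smooth_on_surface_const: "smooth_on_surface A (\<lambda>q. k)"
  by (simp add: smooth_on_surface_def in_chart_def comp_def smooth_map_on_const)

lemma smooth_on_surface_sum:
  assumes "finite I" "\<And>i. i \<in> I \<Longrightarrow> smooth_on_surface A (F i)"
  shows "smooth_on_surface A (\<lambda>q. \<Sum>i\<in>I. F i q)"
  using assms
  by (induction rule: finite_induct)
     (auto intro: smooth_on_surface_const smooth_on_surface_add)

lemma surface_differential_eq:
  assumes "(in_chart (chart_at A p) F has_derivative F') (at (snd (chart_at A p) p))"
  shows "surface_differential A F p X = F' (X (chart_at A p))"
  using frechet_derivative_at[OF assms]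
  by (simp add: surface_differential_def chart_at_def[symmetric] Let_def)

context
  fixes M :: "'m topology" and A :: "'m chart set" and p :: 'm
  assumes atlas: "smooth_atlas M A" and p: "p \<in> topspace M"
begin

lemma in_chart_at_point: "in_chart (chart_at A p) F (snd (chart_at A p) p) = F p"
  using chart_at_contains[OF atlas p] chart_domain(3)[OF atlas] by (simp add: in_chart_def)

lemma surface_has_derivative:
  fixes F :: "'m \<Rightarrow> 'b::euclidean_space"
  assumes "smooth_on_surface A F"
  shows "(in_chart (chart_at A p) F has_derivative
      frechet_derivative (in_chart (chart_at A p) F) (at (snd (chart_at A p) p)))
      (at (snd (chart_at A p) p))"
proof -
  note c = chart_at_contains[OF atlas p]
  have "in_chart (chart_at A p) F differentiable at (snd (chart_at A p) p)"
    using assms c chart_domain(2)[OF atlas c(1)]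
    by (intro smooth_map_on_open_differentiable[of "snd (chart_at A p) ` fst (chart_at A p)"])
       (auto simp: smooth_on_surface_def)
  then show ?thesis by (simp add: frechet_derivative_works[symmetric])
qed

lemma surface_differential_cong:
  fixes F G :: "'m \<Rightarrow> 'b::euclidean_space"
  assumes F: "smooth_on_surface A F" and eq: "\<And>q. q \<in> topspace M \<Longrightarrow> F q = G q"
  shows "surface_differential A G p X = surface_differential A F p X"
proof -
  note c = chart_at_contains[OF atlas p]
  let ?c = "chart_at A p"
  have "(in_chart ?c G has_derivative frechet_derivative (in_chart ?c F) (at (snd ?c p)))
      (at (snd ?c p))"
  proof (rule has_derivative_transform_within_open[OF surface_has_derivative[OF F]
        chart_domain(2)[OF atlas c(1)]])
    fix z assume "z \<in> snd ?c ` fst ?c"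
    then have "inv_into (fst ?c) (snd ?c) z \<in> topspace M"
      using chart_domain(1)[OF atlas c(1)] by (metis inv_into_into subsetD)
    then show "in_chart ?c F z = in_chart ?c G z" using eq by (simp add: in_chart_def)
  qed (use c in blast)
  from surface_differential_eq[OF this] surface_differential_eq[OF surface_has_derivative[OF F]]
  show ?thesis by simp
qed

lemma surface_differential_bilinear:
  fixes F :: "'m \<Rightarrow> 'a::euclidean_space" and G :: "'m \<Rightarrow> 'b::euclidean_space"
    and B :: "'a \<Rightarrow> 'b \<Rightarrow> 'c::euclidean_space"
  assumes B: "bounded_bilinear B" and F: "smooth_on_surface A F" and G: "smooth_on_surface A G"
  shows "surface_differential A (\<lambda>q. B (F q) (G q)) p X =
    B (F p) (surface_differential A G p X) + B (surface_differential A F p X) (G p)"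
proof -
  have "in_chart (chart_at A p) (\<lambda>q. B (F q) (G q)) =
      (\<lambda>z. B (in_chart (chart_at A p) F z) (in_chart (chart_at A p) G z))"
    by (simp add: in_chart_def comp_def)
  note D = bounded_bilinear.FDERIV[OF B surface_has_derivative[OF F] surface_has_derivative[OF G],
      folded this, unfolded in_chart_at_point]
  show ?thesis
    using surface_differential_eq[OF D] surface_differential_eq[OF surface_has_derivative[OF F]]
      surface_differential_eq[OF surface_has_derivative[OF G]] by simp
qed

lemma surface_differential_linear:
  fixes F :: "'m \<Rightarrow> 'a::euclidean_space" and L :: "'a \<Rightarrow> 'b::euclidean_space"
  assumes L: "bounded_linear L" and F: "smooth_on_surface A F"
  shows "surface_differential A (\<lambda>q. L (F q)) p X = L (surface_differential A F p X)"
proof -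
  have "in_chart (chart_at A p) (\<lambda>q. L (F q)) = (\<lambda>z. L (in_chart (chart_at A p) F z))"
    by (simp add: in_chart_def comp_def)
  note D = bounded_linear.has_derivative[OF L surface_has_derivative[OF F], folded this]
  show ?thesis
    using surface_differential_eq[OF D] surface_differential_eq[OF surface_has_derivative[OF F]]
    by simp
qed

lemma surface_differential_const:
  "surface_differential A (\<lambda>q. k :: 'b::euclidean_space) p X = 0"
proof -
  have "in_chart (chart_at A p) (\<lambda>q. k) = (\<lambda>z. k)" by (simp add: in_chart_def comp_def)
  then show ?thesis using surface_differential_eq[of A p "\<lambda>q. k" "\<lambda>_. 0"] by simp
qed

lemma surface_differential_sum:
  fixes F :: "'i \<Rightarrow> 'm \<Rightarrow> 'b::euclidean_space"
  assumes F: "\<And>i. i \<in> I \<Longrightarrow> smooth_on_surface A (F i)"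
  shows "surface_differential A (\<lambda>q. \<Sum>i\<in>I. F i q) p X = (\<Sum>i\<in>I. surface_differential A (F i) p X)"
proof -
  let ?c = "chart_at A p"
  have "in_chart ?c (\<lambda>q. \<Sum>i\<in>I. F i q) = (\<lambda>z. \<Sum>i\<in>I. in_chart ?c (F i) z)"
    by (simp add: in_chart_def comp_def)
  moreover have "((\<lambda>z. \<Sum>i\<in>I. in_chart ?c (F i) z) has_derivative
      (\<lambda>h. \<Sum>i\<in>I. frechet_derivative (in_chart ?c (F i)) (at (snd ?c p)) h)) (at (snd ?c p))"
    by (intro has_derivative_sum surface_has_derivative F)
  ultimately have "surface_differential A (\<lambda>q. \<Sum>i\<in>I. F i q) p X =
      (\<Sum>i\<in>I. frechet_derivative (in_chart ?c (F i)) (at (snd ?c p)) (X ?c))"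
    using surface_differential_eq[of A p "\<lambda>q. \<Sum>i\<in>I. F i q"] by simp
  then show ?thesis using surface_differential_eq[OF surface_has_derivative[OF F]] by simp
qed

text \<open>Differentiate \<open>f \<bullet> f = 1\<close>.\<close>

lemma surface_differential_orthogonal:
  fixes f :: "'m \<Rightarrow> 'b::euclidean_space"
  assumes f: "smooth_on_surface A f" "f ` topspace M \<subseteq> sphere 0 1"
  shows "f p \<bullet> surface_differential A f p X = 0"
proof -
  have "surface_differential A (\<lambda>q. f q \<bullet> f q) p X = surface_differential A (\<lambda>q. 1) p X"
    by (rule surface_differential_cong[OF smooth_on_surface_const])
       (use f(2) in \<open>auto simp: norm_eq_1\<close>)
  then show ?thesis
    using surface_differential_bilinear[OF bounded_bilinear_inner f(1) f(1)]
    by (simp add: surface_differential_const inner_commute)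
qed

end


section \<open>The Levi-Civita connection of the unit sphere\<close>

definition skew_linear :: "('a::euclidean_space \<Rightarrow> 'a) \<Rightarrow> bool" where
  "skew_linear L \<longleftrightarrow> bounded_linear L \<and> (\<forall>x. x \<bullet> L x = 0)"

lemma skew_linear_bounded: "skew_linear L \<Longrightarrow> bounded_linear L"
  by (simp add: skew_linear_def)

text \<open>The infinitesimal rotation in the plane of \<open>a\<close> and \<open>b\<close>, which is the action of the matrix
  \<open>a b\<^sup>T - b a\<^sup>T\<close>.\<close>

definition rotation_generator :: "'a::euclidean_space \<Rightarrow> 'a \<Rightarrow> 'a \<Rightarrow> 'a" where
  "rotation_generator a b x = (b \<bullet> x) *\<^sub>R a - (a \<bullet> x) *\<^sub>R b"

lemma skew_linear_rotation_generator: "skew_linear (rotation_generator a b)"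
  unfolding skew_linear_def
proof
  show "bounded_linear (rotation_generator a b)"
    unfolding rotation_generator_def
    by (intro bounded_linear_intros)
qed (auto simp: rotation_generator_def inner_diff_right inner_commute)

lemma rotation_generator_reaches:
  assumes "x \<in> sphere 0 1" "x \<bullet> w = 0" shows "rotation_generator w x x = w"
  using assms by (simp add: rotation_generator_def norm_eq_1 inner_commute)

lemma skew_linear_in_vector_fields:
  assumes "skew_linear L" shows "L \<in> vector_fields (sphere 0 1)"
  using assms smooth_map_on_linear
  by (auto simp: vector_fields_def tangent_space_unit_sphere skew_linear_def)

lemma levi_civita_tangent:
  assumes "levi_civita_connection (sphere 0 1) D" "skew_linear A" "skew_linear B" "x \<in> sphere 0 1"
  shows "D A B x \<in> tangent_space (sphere 0 1) x"
proof -
  have "D A B \<in> vector_fields (sphere 0 1)"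
    using assms(1)[unfolded levi_civita_connection_def affine_connection_def,
        THEN conjunct1, THEN conjunct1] assms(2,3)[THEN skew_linear_in_vector_fields]
    by blast
  then show ?thesis using assms(4) by (simp add: vector_fields_def)
qed

text \<open>Linear functions \<open>y \<mapsto> y \<bullet> a\<close> separate vectors, so it suffices to test the torsion identity
  on them, and for linear fields their second derivatives are explicit.\<close>

lemma levi_civita_commutator:
  assumes D: "levi_civita_connection (sphere 0 1) D" and "skew_linear A" "skew_linear B"
    and x: "x \<in> sphere 0 1"
  shows "D A B x - D B A x = B (A x) - A (B x)"
proof (rule vector_eq_rdot[THEN iffD1], rule)
  fix a :: 'a
  let ?S = "sphere 0 1 :: 'a set" and ?g = "\<lambda>y. y \<bullet> a"
  note lin = skew_linear_bounded[OF assms(2)] skew_linear_bounded[OF assms(3)]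
  note vf = skew_linear_in_vector_fields[OF assms(2)] skew_linear_in_vector_fields[OF assms(3)]
  have g: "bounded_linear ?g" by (rule bounded_linear_inner_left)
  \<comment> \<open>Off the sphere \<open>field_derivative\<close> has no meaning, so linearity of \<open>field_derivative ?S W ?g\<close>
    is available on the sphere only; this determines its differential on tangent vectors.\<close>
  have fd: "field_derivative ?S V ?g y = V y \<bullet> a" if "V \<in> vector_fields ?S" "y \<in> ?S" for V y
    using that differential_linear_on[OF g] by (simp add: field_derivative_def vector_fields_def)
  have fd2: "field_derivative ?S V (field_derivative ?S W ?g) x = W (V x) \<bullet> a"
    if "V \<in> vector_fields ?S" "W \<in> vector_fields ?S" "bounded_linear W" for V W
    unfolding field_derivative_def[of ?S V]
    by (rule differential_linear_on[of "\<lambda>y. W y \<bullet> a"])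
       (use that x fd in \<open>auto simp: vector_fields_def intro: bounded_linear_compose[OF g]\<close>)
  have "D A B x - D B A x \<in> tangent_space ?S x"
    using levi_civita_tangent[OF D] assms
    by (simp add: tangent_space_unit_sphere inner_diff_right)
  then have "differential ?S ?g x (D A B x - D B A x) = (D A B x - D B A x) \<bullet> a"
    using differential_linear_on[OF g x] by simp
  moreover have "differential ?S ?g x (D A B x - D B A x) =
      field_derivative ?S A (field_derivative ?S B ?g) x
      - field_derivative ?S B (field_derivative ?S A ?g) x"
    using D vf x smooth_map_on_linear[OF g] unfolding levi_civita_connection_def by blast
  ultimately show "(D A B x - D B A x) \<bullet> a = (B (A x) - A (B x)) \<bullet> a"
    using fd2 vf lin by (simp add: inner_diff_left)
qed

text \<open>Metric compatibility, with the derivative of \<open>B y \<bullet> C y\<close> along \<open>A\<close> computed in the ambient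
  space.\<close>

lemma levi_civita_metric:
  assumes D: "levi_civita_connection (sphere 0 1) D"
    and "skew_linear A" "skew_linear B" "skew_linear C" and x: "x \<in> sphere 0 1"
  shows "D A B x \<bullet> C x + B x \<bullet> D A C x = B (A x) \<bullet> C x + B x \<bullet> C (A x)"
proof -
  note vf = assms(2,3,4)[THEN skew_linear_in_vector_fields]
  have "field_derivative (sphere 0 1) A (\<lambda>y. B y \<bullet> C y) x = B x \<bullet> C (A x) + B (A x) \<bullet> C x"
    unfolding field_derivative_def
    by (rule differential_eq)
       (use assms vf in \<open>auto simp: vector_fields_def skew_linear_def
         intro!: has_derivative_inner bounded_linear_imp_has_derivative\<close>)
  moreover have "field_derivative (sphere 0 1) A (\<lambda>y. B y \<bullet> C y) x
      = D A B x \<bullet> C x + B x \<bullet> D A C x"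
    using D vf x unfolding levi_civita_connection_def by blast
  ultimately show ?thesis by simp
qed

text \<open>The defect \<open>T A B C\<close> between the connection and the tangential part of the ambient derivative
  is symmetric in its first two arguments, by the vanishing torsion, and skew in its last two, by
  metric compatibility. This forces it to vanish: six transpositions, three of each kind,
  carry \<open>T A B C\<close> to \<open>- T A B C\<close>. A tangent vector \<open>w\<close> enters as the value at \<open>x\<close> of the
  infinitesimal rotation \<open>C\<close>.\<close>

lemma levi_civita_skew_linear:
  assumes D: "levi_civita_connection (sphere 0 1) D"
    and A: "skew_linear A" and B: "skew_linear B" and x: "x \<in> sphere 0 1" and w: "x \<bullet> w = 0"
  shows "D A B x \<bullet> w = B (A x) \<bullet> w"
proof -
  define T where "T A B C = (D A B x - B (A x)) \<bullet> C x" for A B C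
  have sym: "T A B C = T B A C" if "skew_linear A" "skew_linear B" for A B C
  proof -
    have "D A B x - B (A x) = D B A x - A (B x)"
      using levi_civita_commutator[OF D that x] by (simp add: algebra_simps)
    then show ?thesis by (simp add: T_def)
  qed
  have skew: "T A B C = - T A C B" if "skew_linear A" "skew_linear B" "skew_linear C" for A B C
    using levi_civita_metric[OF D that x]
    by (simp add: T_def inner_diff_left inner_diff_right inner_commute[of _ "B x"])
  define C where "C = rotation_generator w x"
  have C: "skew_linear C" "C x = w"
    unfolding C_def using x w
    by (auto intro: skew_linear_rotation_generator rotation_generator_reaches)
  have "T A B C = - T A B C"
    using sym[OF A B, of C] skew[OF B A C(1)] sym[OF B C(1), of A] skew[OF C(1) B A]
      sym[OF C(1) A, of B] skew[OF A C(1) B] by simp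
  then show ?thesis using C by (simp add: T_def inner_diff_left)
qed


section \<open>The induced connection along a surface in the unit sphere\<close>

lemma fields_along_unit_sphere:
  assumes "f ` topspace M \<subseteq> sphere 0 1"
  shows "fields_along M A f (sphere 0 1) =
    {\<xi>. smooth_on_surface A \<xi> \<and> (\<forall>q\<in>topspace M. f q \<bullet> \<xi> q = 0)}"
  using assms by (fastforce simp: fields_along_def tangent_space_unit_sphere image_subset_iff)

lemma induced_connection_add:
  assumes "induced_connection M A f S D nab" "p \<in> topspace M" "X \<in> tangent_vectors A p"
    "\<xi> \<in> fields_along M A f S" "\<zeta> \<in> fields_along M A f S"
  shows "nab p X (\<lambda>q. \<xi> q + \<zeta> q) = nab p X \<xi> + nab p X \<zeta>"
  using assms unfolding induced_connection_def by blast

lemma induced_connection_Leibniz: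
  assumes "induced_connection M A f S D nab" "p \<in> topspace M" "X \<in> tangent_vectors A p"
    "\<xi> \<in> fields_along M A f S" "smooth_on_surface A g"
  shows "nab p X (\<lambda>q. g q *\<^sub>R \<xi> q) = surface_differential A g p X *\<^sub>R \<xi> p + g p *\<^sub>R nab p X \<xi>"
  using assms unfolding induced_connection_def by blast

lemma induced_connection_restrict:
  assumes "induced_connection M A f S D nab" "p \<in> topspace M" "X \<in> tangent_vectors A p"
    "V \<in> vector_fields S" "W \<in> vector_fields S" "V (f p) = surface_differential A f p X"
  shows "nab p X (\<lambda>q. W (f q)) = D V W (f p)"
  using assms unfolding induced_connection_def by blast

text \<open>The values of a field outside the surface do not matter: multiply it by the indicator function of
  the surface, which is smooth with vanishing differential, and use the Leibniz rule.\<close>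

lemma induced_connection_cong:
  assumes atlas: "smooth_atlas M A" and nab: "induced_connection M A f S D nab"
    and p: "p \<in> topspace M" and X: "X \<in> tangent_vectors A p"
    and xi: "\<xi> \<in> fields_along M A f S" "\<zeta> \<in> fields_along M A f S"
    and eq: "\<And>q. q \<in> topspace M \<Longrightarrow> \<xi> q = \<zeta> q"
  shows "nab p X \<xi> = nab p X \<zeta>"
proof -
  define g :: "'a \<Rightarrow> real" where "g = (\<lambda>q. if q \<in> topspace M then 1 else 0)"
  have g: "smooth_on_surface A g"
    by (rule smooth_on_surface_cong[OF atlas smooth_on_surface_const[of A 1]]) (simp add: g_def)
  have dg: "surface_differential A g p X = 0"
    using surface_differential_cong[OF atlas p smooth_on_surface_const[of A 1], of g X]
      surface_differential_const[OF atlas p] by (simp add: g_def)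
  have loc: "nab p X (\<lambda>q. g q *\<^sub>R \<zeta>' q) = nab p X \<zeta>'" if "\<zeta>' \<in> fields_along M A f S" for \<zeta>'
    using induced_connection_Leibniz[OF nab p X that g] dg p by (simp add: g_def)
  have "(\<lambda>q. g q *\<^sub>R \<xi> q) = (\<lambda>q. g q *\<^sub>R \<zeta> q)" using eq by (auto simp: g_def)
  then show ?thesis using loc xi by metis
qed

lemma induced_connection_sum:
  assumes nab: "induced_connection M A f (sphere 0 1) D nab"
    and p: "p \<in> topspace M" and X: "X \<in> tangent_vectors A p"
    and f: "f ` topspace M \<subseteq> sphere 0 1"
    and I: "finite I" and xi: "\<And>i. i \<in> I \<Longrightarrow> \<xi> i \<in> fields_along M A f (sphere 0 1)"
  shows "nab p X (\<lambda>q. \<Sum>i\<in>I. \<xi> i q) = (\<Sum>i\<in>I. nab p X (\<xi> i))"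
  using I xi
proof (induction rule: finite_induct)
  case empty
  have "(\<lambda>q. 0) \<in> fields_along M A f (sphere 0 1)"
    by (simp add: fields_along_unit_sphere[OF f] smooth_on_surface_const)
  from induced_connection_add[OF nab p X this this] show ?case by simp
next
  case (insert i I)
  have "(\<lambda>q. \<Sum>i\<in>I. \<xi> i q) \<in> fields_along M A f (sphere 0 1)"
    using insert f by (auto simp: fields_along_unit_sphere inner_sum_right
        intro!: smooth_on_surface_sum)
  then have "nab p X (\<lambda>q. \<xi> i q + (\<Sum>i\<in>I. \<xi> i q)) = nab p X (\<xi> i) + nab p X (\<lambda>q. \<Sum>i\<in>I. \<xi> i q)"
    using induced_connection_add[OF nab p X insert.prems] by simp
  then show ?case using insert by simp
qed

text \<open>The matrix \<open>u x\<^sup>T - x u\<^sup>T\<close> sends \<open>x\<close> to \<open>u\<close>; expanding \<open>u\<close> and \<open>x\<close> inside it along the basis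
  writes \<open>u\<close> as a combination of infinitesimal rotations in coordinate planes. The coefficients are
  products of coordinates, hence smooth when \<open>u\<close> and \<open>x\<close> vary smoothly; no choice of a frame is
  involved.\<close>

lemma rotation_generator_expansion:
  fixes u x :: "'a::euclidean_space"
  assumes "x \<in> sphere 0 1" "x \<bullet> u = 0"
  shows "(\<Sum>i\<in>Basis \<times> Basis. ((u \<bullet> fst i) * (x \<bullet> snd i)) *\<^sub>R rotation_generator (fst i) (snd i) x) = u"
proof -
  have "(\<Sum>i\<in>Basis \<times> Basis. ((u \<bullet> fst i) * (x \<bullet> snd i)) *\<^sub>R rotation_generator (fst i) (snd i) x)
    = (\<Sum>a\<in>Basis. \<Sum>b\<in>Basis. ((u \<bullet> a) * (x \<bullet> b)) *\<^sub>R rotation_generator a b x)"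
    by (simp add: sum.cartesian_product case_prod_beta)
  also have "\<dots> = (\<Sum>a\<in>Basis. (x \<bullet> x) *\<^sub>R ((u \<bullet> a) *\<^sub>R a) - ((u \<bullet> a) * (x \<bullet> a)) *\<^sub>R x)"
  proof (rule sum.cong[OF refl])
    fix a :: 'a
    have "(\<Sum>b\<in>Basis. ((u \<bullet> a) * (x \<bullet> b)) *\<^sub>R rotation_generator a b x) =
        (\<Sum>b\<in>Basis. ((x \<bullet> b) * (x \<bullet> b)) *\<^sub>R ((u \<bullet> a) *\<^sub>R a)) -
        (\<Sum>b\<in>Basis. ((u \<bullet> a) * (x \<bullet> a)) *\<^sub>R ((x \<bullet> b) *\<^sub>R b))"
      unfolding sum_subtractf[symmetric]
      by (intro sum.cong refl)
         (simp add: rotation_generator_def scaleR_diff_right inner_commute mult_ac)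
    then show "(\<Sum>b\<in>Basis. ((u \<bullet> a) * (x \<bullet> b)) *\<^sub>R rotation_generator a b x) =
        (x \<bullet> x) *\<^sub>R ((u \<bullet> a) *\<^sub>R a) - ((u \<bullet> a) * (x \<bullet> a)) *\<^sub>R x"
      by (simp only: scaleR_sum_left[symmetric] scaleR_sum_right[symmetric]
          euclidean_inner[symmetric] euclidean_representation)
  qed
  also have "\<dots> = (x \<bullet> x) *\<^sub>R u - (u \<bullet> x) *\<^sub>R x"
    by (simp only: sum_subtractf scaleR_sum_left[symmetric] scaleR_sum_right[symmetric]
        euclidean_inner[symmetric] euclidean_representation)
  finally show ?thesis using assms by (simp add: norm_eq_1 inner_commute)
qed

text \<open>Expand \<open>\<xi>\<close> as in the preceding lemma, with coefficients \<open>g i\<close> and infinitesimal rotations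
  \<open>R i\<close>. On each summand both sides obey the product rule, and they agree on \<open>R i \<circ> f\<close> because the
  Levi-Civita connection is known on infinitesimal rotations.\<close>

lemma induced_connection_unit_sphere:
  fixes f \<xi> :: "'m \<Rightarrow> 'b::euclidean_space"
  assumes atlas: "smooth_atlas M A" and f: "smooth_on_surface A f" "f ` topspace M \<subseteq> sphere 0 1"
    and D: "levi_civita_connection (sphere 0 1) D"
    and nab: "induced_connection M A f (sphere 0 1) D nab"
    and p: "p \<in> topspace M" and X: "X \<in> tangent_vectors A p"
    and xi: "\<xi> \<in> fields_along M A f (sphere 0 1)"
    and w: "f p \<bullet> w = 0"
  shows "nab p X \<xi> \<bullet> w = surface_differential A \<xi> p X \<bullet> w"
proof -
  let ?I = "Basis \<times> Basis :: ('b \<times> 'b) set"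
  define R where "R i = rotation_generator (fst i) (snd i)" for i :: "'b \<times> 'b"
  define g where "g i q = (\<xi> q \<bullet> fst i) * (f q \<bullet> snd i)" for i q
  \<comment> \<open>An infinitesimal rotation whose value at \<open>f p\<close> is the image of the tangent vector \<open>X\<close>.\<close>
  define V where "V = rotation_generator (surface_differential A f p X) (f p)"
  note fields = fields_along_unit_sphere[OF f(2)]
  have R: "skew_linear (R i)" for i unfolding R_def by (rule skew_linear_rotation_generator)
  have fp: "f p \<in> sphere 0 1" using f(2) p by blast
  have V: "skew_linear V" "V (f p) = surface_differential A f p X"
    unfolding V_def using fp surface_differential_orthogonal[OF atlas p f]
    by (auto intro: skew_linear_rotation_generator rotation_generator_reaches)
  have xi_smooth: "smooth_on_surface A \<xi>" using xi by (simp add: fields)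
  have g: "smooth_on_surface A (g i)" for i
    unfolding g_def
    by (intro smooth_on_surface_bilinear[OF bounded_bilinear_mult]
        smooth_on_surface_linear[OF bounded_linear_inner_left] xi_smooth f)
  have Rf: "smooth_on_surface A (\<lambda>q. R i (f q))" for i
    by (rule smooth_on_surface_linear[OF skew_linear_bounded[OF R] f(1)])
  have gR: "smooth_on_surface A (\<lambda>q. g i q *\<^sub>R R i (f q))" for i
    by (rule smooth_on_surface_bilinear[OF bounded_bilinear_scaleR g Rf])
  have Rf_field: "(\<lambda>q. R i (f q)) \<in> fields_along M A f (sphere 0 1)" for i
    using Rf R by (simp add: fields skew_linear_def)
  have gR_field: "(\<lambda>q. g i q *\<^sub>R R i (f q)) \<in> fields_along M A f (sphere 0 1)" for i
    using gR R by (simp add: fields skew_linear_def)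
  have sum_field: "(\<lambda>q. \<Sum>i\<in>?I. g i q *\<^sub>R R i (f q)) \<in> fields_along M A f (sphere 0 1)"
    using R by (auto simp: fields skew_linear_def inner_sum_right
        intro!: smooth_on_surface_sum gR)
  have expand: "(\<Sum>i\<in>?I. g i q *\<^sub>R R i (f q)) = \<xi> q" if "q \<in> topspace M" for q
    unfolding g_def R_def
    by (rule rotation_generator_expansion) (use that f(2) xi in \<open>auto simp: fields\<close>)
  have nabR: "nab p X (\<lambda>q. R i (f q)) \<bullet> w = R i (surface_differential A f p X) \<bullet> w" for i
  proof -
    have "nab p X (\<lambda>q. R i (f q)) = D V (R i) (f p)"
      by (rule induced_connection_restrict[OF nab p X skew_linear_in_vector_fields[OF V(1)]
            skew_linear_in_vector_fields[OF R] V(2)])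
    then show ?thesis using levi_civita_skew_linear[OF D V(1) R fp w] V(2) by simp
  qed
  have nab_gR: "nab p X (\<lambda>q. g i q *\<^sub>R R i (f q)) =
      surface_differential A (g i) p X *\<^sub>R R i (f p) + g i p *\<^sub>R nab p X (\<lambda>q. R i (f q))" for i
    by (rule induced_connection_Leibniz[OF nab p X Rf_field g])
  have d_gR: "surface_differential A (\<lambda>q. g i q *\<^sub>R R i (f q)) p X =
      g i p *\<^sub>R R i (surface_differential A f p X) + surface_differential A (g i) p X *\<^sub>R R i (f p)" for i
    using surface_differential_bilinear[OF atlas p bounded_bilinear_scaleR g Rf]
      surface_differential_linear[OF atlas p skew_linear_bounded[OF R] f(1)] by simp
  have "nab p X \<xi> = nab p X (\<lambda>q. \<Sum>i\<in>?I. g i q *\<^sub>R R i (f q))"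
    by (rule induced_connection_cong[OF atlas nab p X xi sum_field]) (simp add: expand)
  also have "\<dots> = (\<Sum>i\<in>?I. nab p X (\<lambda>q. g i q *\<^sub>R R i (f q)))"
    by (rule induced_connection_sum[OF nab p X f(2)]) (auto simp: gR_field)
  finally have "nab p X \<xi> \<bullet> w = (\<Sum>i\<in>?I. surface_differential A (\<lambda>q. g i q *\<^sub>R R i (f q)) p X) \<bullet> w"
    by (simp add: inner_sum_left nab_gR d_gR inner_add_left nabR add.commute)
  also have "(\<Sum>i\<in>?I. surface_differential A (\<lambda>q. g i q *\<^sub>R R i (f q)) p X) =
      surface_differential A (\<lambda>q. \<Sum>i\<in>?I. g i q *\<^sub>R R i (f q)) p X"
    by (rule surface_differential_sum[OF atlas p, symmetric]) (rule gR)
  also have "\<dots> = surface_differential A \<xi> p X"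
    by (rule surface_differential_cong[OF atlas p xi_smooth]) (simp add: expand)
  finally show ?thesis .
qed

section \<open>Wedges of vectors and rotations in a plane\<close>

definition wedge :: "real^'n \<Rightarrow> real^'n \<Rightarrow> real^'n^'n" where
  "wedge u v = (\<chi> i j. u $ i * v $ j - v $ i * u $ j)"

lemma wedge_mult_vector: "wedge u v *v w = (v \<bullet> w) *\<^sub>R u - (u \<bullet> w) *\<^sub>R v"
  by (simp add: vec_eq_iff wedge_def matrix_vector_mult_def inner_vec_def sum_subtractf
      left_diff_distrib right_diff_distrib sum_distrib_left sum_distrib_right mult_ac)

lemma transpose_wedge: "transpose (wedge u v) = - wedge u v"
  by (simp add: vec_eq_iff wedge_def transpose_def)

lemma bounded_bilinear_wedge: "bounded_bilinear wedge"
  unfolding bilinear_conv_bounded_bilinear[symmetric] bilinear_def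
  by (auto intro!: linearI simp: vec_eq_iff wedge_def algebra_simps)

lemma bounded_linear_matrix_mult_left: "bounded_linear (\<lambda>y::real^'n^'n. x ** y)" for x :: "real^'n^'n"
  unfolding linear_conv_bounded_linear[symmetric]
  by (rule linearI) (simp_all add: matrix_add_ldistrib matrix_scalar_ac scalar_matrix_assoc[symmetric])

lemma bounded_linear_matrix_mult_right: "bounded_linear (\<lambda>y::real^'n^'n. y ** x)" for x :: "real^'n^'n"
  unfolding linear_conv_bounded_linear[symmetric]
  by (rule linearI) (simp_all add: matrix_matrix_mult_def vec_eq_iff sum.distrib distrib_right sum_distrib_left
      mult.assoc)

lemma bounded_linear_transpose: "bounded_linear (transpose :: real^'n^'n \<Rightarrow> real^'n^'n)"
  unfolding linear_conv_bounded_linear[symmetric]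
  by (rule linearI) (simp_all add: transpose_def vec_eq_iff)

lemma bounded_linear_matrix_vector: "bounded_linear (\<lambda>y::real^'n^'n. y *v v)"
  unfolding linear_conv_bounded_linear[symmetric]
  by (rule linearI) (simp_all add: matrix_vector_mult_add_rdistrib scaleR_matrix_vector_assoc)

lemma bounded_bilinear_matrix_mult:
  "bounded_bilinear ((**) :: real^'n^'n \<Rightarrow> real^'n^'n \<Rightarrow> real^'n^'n)"
  unfolding bilinear_conv_bounded_bilinear[symmetric] bilinear_def
  by (blast intro: bounded_linear.linear bounded_linear_matrix_mult_left
      bounded_linear_matrix_mult_right)

lemma conjugate_wedge:
  "x ** wedge a b ** transpose x = wedge (x *v a) (x *v b)" for x :: "real^'n^'n"
  unfolding matrix_eq
  by (simp add: matrix_vector_mul_assoc[symmetric] wedge_mult_vector matrix_vector_mult_diff_distrib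
      matrix_vector_mult_scaleR inner_commute[of _ "_ v* _"] dot_lmul_matrix)
     (simp add: inner_commute)

text \<open>The metric on the Lie algebra is half the Euclidean inner product of matrices; in particular it
  is bilinear and symmetric.\<close>

lemma lie_inner_eq: "lie_inner u v = (u \<bullet> v) / 2"
  by (simp add: lie_inner_def trace_def matrix_matrix_mult_def transpose_def inner_vec_def)

lemma skew_matrix_nth:
  fixes B :: "real^'n^'n"
  assumes "transpose B = - B" shows "B $ j $ i = - B $ i $ j"
proof -
  have "B $ j $ i = transpose B $ i $ j" by (simp add: transpose_def)
  also have "\<dots> = - B $ i $ j" unfolding assms by simp
  finally show ?thesis .
qed

lemma lie_inner_wedge_skew:
  assumes "transpose B = - B" shows "lie_inner (wedge u v) B = u \<bullet> (B *v v)"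
proof -
  have swapped: "v $ j * u $ i * B $ j $ i = - (u $ i * v $ j * B $ i $ j)" for i j
    using skew_matrix_nth[OF assms, of j i] by simp
  have "(\<Sum>i\<in>UNIV. \<Sum>j\<in>UNIV. v $ i * u $ j * B $ i $ j) =
      (\<Sum>i\<in>UNIV. \<Sum>j\<in>UNIV. v $ j * u $ i * B $ j $ i)"
    by (rule sum.swap)
  also have "\<dots> = - (\<Sum>i\<in>UNIV. \<Sum>j\<in>UNIV. u $ i * v $ j * B $ i $ j)"
    by (simp only: swapped sum_negf)
  finally have "wedge u v \<bullet> B = 2 * (\<Sum>i\<in>UNIV. \<Sum>j\<in>UNIV. u $ i * v $ j * B $ i $ j)"
    by (simp add: wedge_def inner_vec_def left_diff_distrib sum_subtractf)
  moreover have "u \<bullet> (B *v v) = (\<Sum>i\<in>UNIV. \<Sum>j\<in>UNIV. u $ i * v $ j * B $ i $ j)"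
    by (simp add: inner_vec_def matrix_vector_mult_def sum_distrib_left mult_ac)
  ultimately show ?thesis by (simp add: lie_inner_eq)
qed

lemma lie_inner_wedge:
  "lie_inner (wedge a b) (wedge c d) = (a \<bullet> c) * (b \<bullet> d) - (a \<bullet> d) * (b \<bullet> c)"
  by (simp add: lie_inner_wedge_skew transpose_wedge wedge_mult_vector inner_diff_right inner_commute)

lemma matrix_inv_orthogonal:
  fixes x :: "real^'n^'n"
  assumes "orthogonal_matrix x" shows "matrix_inv x = transpose x"
  unfolding matrix_inv_def
proof (rule some_equality)
  show "x ** transpose x = mat 1 \<and> transpose x ** x = mat 1"
    using assms by (simp add: orthogonal_matrix_def)
  show "y = transpose x" if "x ** y = mat 1 \<and> y ** x = mat 1" for y
    using that assms by (metis matrix_mul_assoc matrix_mul_lid matrix_mul_rid orthogonal_matrix_def)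
qed


text \<open>Rodrigues' formula for \<open>exp (t W)\<close>, where \<open>W = wedge w z\<close> and \<open>w\<close>, \<open>z\<close> are orthonormal, so
  that \<open>W\<^sup>3 = - W\<close>.\<close>

definition plane_rotation :: "real^'n \<Rightarrow> real^'n \<Rightarrow> real \<Rightarrow> real^'n^'n" where
  "plane_rotation w z t =
    mat 1 + (1 - cos t) *\<^sub>R (wedge w z ** wedge w z) + sin t *\<^sub>R wedge w z"

text \<open>Only the components in the plane of \<open>w\<close> and \<open>z\<close> change; in particular the rotation fixes every
  vector orthogonal to that plane.\<close>

lemma plane_rotation_mult_vector:
  fixes w z :: "real^'n"
  assumes "w \<bullet> w = 1" "z \<bullet> z = 1" "w \<bullet> z = 0"
  shows "plane_rotation w z t *v v = v + ((cos t - 1) * (w \<bullet> v) + sin t * (z \<bullet> v)) *\<^sub>R w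
    + ((cos t - 1) * (z \<bullet> v) - sin t * (w \<bullet> v)) *\<^sub>R z"
  using assms
  by (simp add: plane_rotation_def matrix_vector_mult_add_rdistrib wedge_mult_vector
      scaleR_matrix_vector_assoc[symmetric] matrix_vector_mul_assoc[symmetric]
      inner_diff_right inner_commute[of z w] algebra_simps)

lemma orthogonal_plane_rotation:
  fixes w z :: "real^'n"
  assumes "w \<bullet> w = 1" "z \<bullet> z = 1" "w \<bullet> z = 0"
  shows "orthogonal_matrix (plane_rotation w z t)"
proof -
  have "norm (plane_rotation w z t *v v) = norm v" for v
  proof -
    define a b where "a = w \<bullet> v" and "b = z \<bullet> v"
    define \<alpha> \<beta> where "\<alpha> = (cos t - 1) * a + sin t * b" and "\<beta> = (cos t - 1) * b - sin t * a"
    have ab: "w \<bullet> v = a" "v \<bullet> w = a" "z \<bullet> v = b" "v \<bullet> z = b" "z \<bullet> w = 0"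
      using assms(3) by (simp_all add: a_def b_def inner_commute)
    have "(v + \<alpha> *\<^sub>R w + \<beta> *\<^sub>R z) \<bullet> (v + \<alpha> *\<^sub>R w + \<beta> *\<^sub>R z) =
        v \<bullet> v + 2 * \<alpha> * a + 2 * \<beta> * b + \<alpha>\<^sup>2 + \<beta>\<^sup>2"
      by (simp add: inner_add_left inner_add_right ab assms power2_eq_square distrib_left)
    also have "\<dots> = v \<bullet> v + ((sin t)\<^sup>2 + (cos t)\<^sup>2 - 1) * (a\<^sup>2 + b\<^sup>2)"
      unfolding \<alpha>_def \<beta>_def by algebra
    also have "\<dots> = v \<bullet> v" by simp
    finally show ?thesis
      unfolding plane_rotation_mult_vector[OF assms] norm_eq ab \<alpha>_def[symmetric]
         \<beta>_def[symmetric] .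
  qed
  then have "orthogonal_transformation ((*v) (plane_rotation w z t))"
    by (simp add: orthogonal_transformation)
  then show ?thesis by (simp add: orthogonal_transformation_matrix)
qed

text \<open>The curve \<open>t \<mapsto> x exp (t r W)\<close> has initial velocity \<open>r x W\<close>.\<close>

lemma plane_rotation_velocity:
  fixes x :: "real^'n^'n"
  assumes "\<And>t. x ** plane_rotation w z t \<in> S"
  shows "r *\<^sub>R (x ** wedge w z) \<in> tangent_space S x"
proof -
  let ?P = "x ** (wedge w z ** wedge w z)"
  have "x ** plane_rotation w z (r * t) =
      (x + ?P) + cos (r * t) *\<^sub>R (- ?P) + sin (r * t) *\<^sub>R (x ** wedge w z)" for t
    by (simp add: plane_rotation_def matrix_add_ldistrib matrix_scalar_ac
        scalar_matrix_assoc[symmetric] scaleR_diff_left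
        linear_diff[OF bounded_linear.linear[OF bounded_linear_matrix_mult_left]])
  then have "r *\<^sub>R (x ** wedge w z) \<in> tangent_space S ((x + ?P) + - ?P)"
    using assms by (intro trig_velocity_in_tangent_space) metis
  then show ?thesis by simp
qed

section \<open>Horizontal lifts in \<open>O(4)\<close> and the maps \<open>\<Gamma>\<^sub>p\<close>\<close>

text \<open>Differentiate \<open>y\<^sup>T y = 1\<close>.\<close>

lemma tangent_orthogonal_skew:
  assumes "v \<in> tangent_space O4 x" "x \<in> O4"
  shows "transpose (transpose x ** v) = - (transpose x ** v)"
proof -
  have "transpose x ** v + transpose v ** x = 0"
    by (rule tangent_constraint[OF assms(1) bounded_bilinear.FDERIV[OF bounded_bilinear_matrix_mult
            bounded_linear_imp_has_derivative[OF bounded_linear_transpose] has_derivative_ident]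
          _ assms(2)])
       (simp add: O4_def orthogonal_matrix)
  then show ?thesis by (simp add: matrix_transpose_mul eq_neg_iff_add_eq_0 add.commute)
qed

lemma e1_nth: "e1 $ i = (if i = 1 then 1 else 0)" by (simp add: e1_def axis_def)

lemma e1_unit: "e1 \<bullet> e1 = 1" by (simp add: e1_def inner_axis_axis)

context
  fixes x :: "real^4^4"
  assumes x: "x \<in> O4"
begin

lemma O4_cancel: "transpose x ** (x ** y) = y" "x ** (transpose x ** y) = y"
  using x by (simp_all add: matrix_mul_assoc O4_def orthogonal_matrix_def)

lemma metric_O4_eq: "metric_O4 x u v = lie_inner (transpose x ** u) (transpose x ** v)"
  using x by (simp add: metric_O4_def matrix_inv_orthogonal O4_def)

lemma coset_subset_O4: "(\<lambda>y. x ** y) ` O3 \<subseteq> O4"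
  using x by (auto simp: O4_def O3_def orthogonal_matrix_mul)

lemma mem_coset: "x \<in> (\<lambda>y. x ** y) ` O3"
  by (rule image_eqI[of _ _ "mat 1"]) (simp_all add: O3_def O4_def orthogonal_matrix_id)

lemma differential_proj_S3:
  "h \<in> tangent_space O4 x \<Longrightarrow> differential O4 proj_S3 x h = h *v e1"
  by (rule differential_linear_on[OF bounded_linear_matrix_vector x]) (simp_all add: proj_S3_def)

lemma rotation_direction_tangent:
  assumes a: "a \<bullet> e1 = 0"
  shows "x ** wedge a e1 \<in> tangent_space O4 x"
proof -
  obtain w r where w: "w \<bullet> w = 1" "w \<bullet> e1 = 0" "a = r *\<^sub>R w"
  proof (cases "a = 0")
    case True
    \<comment> \<open>Any unit vector orthogonal to \<open>e1\<close> will do, at speed \<open>0\<close>.\<close>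
    show thesis
      by (rule that[of "axis 2 1" 0]) (simp_all add: True inner_axis_axis e1_def)
  next
    case False
    show thesis
    proof (rule that[of "sgn a" "norm a"])
      show "sgn a \<bullet> sgn a = 1" using False by (metis norm_eq_1 norm_sgn)
    qed (use False a in \<open>simp_all add: sgn_div_norm\<close>)
  qed
  have "r *\<^sub>R (x ** wedge w e1) \<in> tangent_space O4 x"
    by (rule plane_rotation_velocity)
       (use x w e1_unit in \<open>auto simp: O4_def
         intro!: orthogonal_matrix_mul orthogonal_plane_rotation\<close>)
  then show ?thesis
    by (simp add: w(3) bounded_bilinear.scaleR_left[OF bounded_bilinear_wedge] matrix_scalar_ac
        scalar_matrix_assoc[symmetric])
qed

lemma vertical_direction_tangent:
  assumes "w \<bullet> w = 1" "z \<bullet> z = 1" "w \<bullet> z = 0" "w \<bullet> e1 = 0" "z \<bullet> e1 = 0"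
  shows "x ** wedge w z \<in> tangent_space ((\<lambda>y. x ** y) ` O3) x"
proof -
  have "plane_rotation w z t \<in> O3" for t
    using orthogonal_plane_rotation[OF assms(1-3)] assms(4,5)
    by (simp add: O3_def O4_def plane_rotation_mult_vector[OF assms(1-3)])
  then have "1 *\<^sub>R (x ** wedge w z) \<in> tangent_space ((\<lambda>y. x ** y) ` O3) x"
    by (intro plane_rotation_velocity) auto
  then show ?thesis by simp
qed

text \<open>The elements of the coset all send \<open>e1\<close> to the same point.\<close>

lemma vertical_kills_e1:
  assumes v: "v \<in> tangent_space ((\<lambda>y. x ** y) ` O3) x" shows "v *v e1 = 0"
  by (rule tangent_constraint[OF v bounded_linear_imp_has_derivative[OF bounded_linear_matrix_vector]
        _ mem_coset, where c = "x *v e1"])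
     (auto simp: O3_def matrix_vector_mul_assoc[symmetric])

text \<open>For a vertical vector \<open>v\<close> the matrix \<open>x\<^sup>T v\<close> is skew and kills \<open>e1\<close>, so its inner product with
  \<open>a \<and> e\<^sub>1\<close>, which is \<open>a \<bullet> x\<^sup>T v e\<^sub>1\<close>, vanishes.\<close>

lemma horizontal_lift_mem:
  assumes a: "a \<bullet> e1 = 0" shows "x ** wedge a e1 \<in> horizontal x"
proof -
  have "metric_O4 x (x ** wedge a e1) v = 0"
    if v: "v \<in> tangent_space ((\<lambda>y. x ** y) ` O3) x" for v
  proof -
    have "v \<in> tangent_space O4 x" using v tangent_space_mono[OF coset_subset_O4] by blast
    from tangent_orthogonal_skew[OF this x] have "metric_O4 x (x ** wedge a e1) v = a \<bullet> (transpose x ** v *v e1)"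
      by (simp add: metric_O4_eq O4_cancel lie_inner_wedge_skew)
    also have "\<dots> = 0"
      using vertical_kills_e1[OF v] by (simp only: matrix_vector_mul_assoc[symmetric]) simp
    finally show ?thesis .
  qed
  then show ?thesis using rotation_direction_tangent[OF a] by (simp add: horizontal_def)
qed

text \<open>A horizontal vector is determined by its image under the projection. The matrix \<open>B = x\<^sup>T h\<close> is
  skew, and orthogonality to the vertical rotations in the coordinate planes that do not contain
  \<open>e1\<close> makes its entries outside the first row and column zero; so \<open>B\<close> is known from its first
  column, which is \<open>x\<^sup>T h e\<^sub>1\<close>.\<close>

lemma horizontal_unique:
  assumes h: "h \<in> horizontal x" shows "h = x ** wedge ((h *v e1) v* x) e1"
proof -
  define B where "B = transpose x ** h"
  have hT: "h \<in> tangent_space O4 x" using h by (simp add: horizontal_def)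
  have skew: "transpose B = - B"
    unfolding B_def by (rule tangent_orthogonal_skew[OF hT x])
  note B_skew = skew_matrix_nth[OF skew]
  have B_col: "B $ i $ 1 = (B *v e1) $ i" for i
    by (simp add: e1_def matrix_vector_mult_basis column_def)
  have zero: "B $ i $ j = 0" if "i \<noteq> 1" "j \<noteq> 1" for i j
  proof (cases "i = j")
    case True
    then show ?thesis using B_skew[of i i] by simp
  next
    case False
    have "x ** wedge (axis i 1) (axis j 1) \<in> tangent_space ((\<lambda>y. x ** y) ` O3) x"
      using False that by (intro vertical_direction_tangent) (auto simp: inner_axis_axis e1_def)
    then have "metric_O4 x h (x ** wedge (axis i 1) (axis j 1)) = 0"
      using h by (simp add: horizontal_def)
    then have "lie_inner (wedge (axis i 1) (axis j 1)) B = 0"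
      by (simp add: metric_O4_eq O4_cancel B_def lie_inner_eq inner_commute)
    then show ?thesis
      by (simp add: lie_inner_wedge_skew[OF skew] matrix_vector_mult_basis column_def inner_axis')
  qed
  have "B $ i $ j = wedge (B *v e1) e1 $ i $ j" for i j
    using zero[of i j] B_skew[of 1 j] B_skew[of 1 1] B_skew[of i j]
    by (cases "i = 1"; cases "j = 1") (auto simp: wedge_def B_col[symmetric] e1_nth)
  then have "B = wedge (B *v e1) e1" by (simp add: vec_eq_iff)
  moreover have "B *v e1 = (h *v e1) v* x" by (simp add: B_def matrix_vector_mul_assoc[symmetric])
  moreover have "x ** B = h" by (simp add: B_def O4_cancel)
  ultimately show ?thesis by metis
qed

lemma O4_apply_inverse: "x *v (u v* x) = u"
  using x unfolding transpose_matrix_vector[symmetric]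
  by (simp add: matrix_vector_mul_assoc O4_def orthogonal_matrix_def del: transpose_matrix_vector)

lemma ell_inv_eq:
  assumes u: "u \<bullet> (x *v e1) = 0" shows "ell_inv x u = x ** wedge (u v* x) e1"
  unfolding ell_inv_def inv_into_def
proof (rule some_equality)
  have a: "(u v* x) \<bullet> e1 = 0" using u by (simp add: dot_lmul_matrix)
  note H = horizontal_lift_mem[OF a]
  have "x ** wedge (u v* x) e1 *v e1 = x *v (u v* x)"
    using a e1_unit by (simp add: matrix_vector_mul_assoc[symmetric] wedge_mult_vector)
  also have "\<dots> = u" by (rule O4_apply_inverse)
  finally show "x ** wedge (u v* x) e1 \<in> horizontal x \<and>
      differential O4 proj_S3 x (x ** wedge (u v* x) e1) = u"
    using H differential_proj_S3 by (simp add: horizontal_def)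
  show "h = x ** wedge (u v* x) e1"
    if "h \<in> horizontal x \<and> differential O4 proj_S3 x h = u" for h
    using that horizontal_unique[of h] differential_proj_S3[of h] by (simp add: horizontal_def)
qed

lemma right_translated_lift:
  assumes u: "u \<bullet> (x *v e1) = 0"
  shows "differential O4 (\<lambda>z. z ** matrix_inv x) x (ell_inv x u) = wedge u (x *v e1)"
proof -
  have a: "(u v* x) \<bullet> e1 = 0" using u by (simp add: dot_lmul_matrix)
  have "x ** wedge (u v* x) e1 ** transpose x = wedge u (x *v e1)"
    by (simp add: conjugate_wedge O4_apply_inverse)
  moreover have "differential O4 (\<lambda>z. z ** transpose x) x h = h ** transpose x"
    if "h \<in> tangent_space O4 x" for h
    by (rule differential_linear_on[OF bounded_linear_matrix_mult_right x _ that]) simp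
  ultimately show ?thesis
    using x rotation_direction_tangent[OF a] ell_inv_eq[OF u]
    by (simp add: matrix_inv_orthogonal O4_def)
qed

end

text \<open>Right translation conjugates \<open>x\<^sup>T u \<and> e\<^sub>1\<close> by \<open>x\<close>. The result depends on \<open>x\<close> only through
  \<open>x e\<^sub>1 = p\<close>, so the choice of \<open>x\<close> in the definition of \<open>\<Gamma>\<^sub>p\<close> is immaterial.\<close>

theorem Gamma_eq_wedge:
  assumes p: "p \<in> S3" and u: "p \<bullet> u = 0" shows "Gamma p u = wedge u p"
proof -
  have "norm p = 1" using p by (simp add: S3_def)
  then obtain y where "orthogonal_matrix y" "y *v axis 1 1 = p"
    by (rule orthogonal_matrix_exists_basis)
  then have "\<exists>x. x \<in> O4 \<and> proj_S3 x = p" by (auto simp: O4_def proj_S3_def e1_def)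
  then have "(SOME x. x \<in> O4 \<and> proj_S3 x = p) \<in> O4 \<and> proj_S3 (SOME x. x \<in> O4 \<and> proj_S3 x = p) = p"
    by (rule someI_ex)
  then show ?thesis
    using u right_translated_lift[of "SOME x. x \<in> O4 \<and> proj_S3 x = p" u]
    by (simp add: Gamma_def Let_def proj_S3_def inner_commute)
qed

section \<open>The Gauss map and the shape operator\<close>

theorem proposition5:
  fixes M :: "'m topology" and A :: "'m chart set"
    and f \<eta> :: "'m \<Rightarrow> real^4"
    and D :: "(real^4 \<Rightarrow> real^4) \<Rightarrow> (real^4 \<Rightarrow> real^4) \<Rightarrow> real^4 \<Rightarrow> real^4"
    and nab :: "'m \<Rightarrow> ('m chart \<Rightarrow> real^2) \<Rightarrow> ('m \<Rightarrow> real^4) \<Rightarrow> real^4"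
    and p :: 'm and X Y :: "'m chart \<Rightarrow> real^2"
  assumes "orientable_surface M A"
    and "immersion_into M A f S3"
    and "unit_normal_field M A f \<eta>"
    and "levi_civita_connection S3 D"
    and "induced_connection M A f S3 D nab"
    and "p \<in> topspace M"
    and "X \<in> tangent_vectors A p" and "Y \<in> tangent_vectors A p"
  shows "lie_inner (surface_differential A (gauss_map f \<eta>) p X)
           (Gamma (f p) (surface_differential A f p Y))
         = - (shape_operator nab \<eta> p X \<bullet> surface_differential A f p Y)"
proof -
  define Y' where "Y' = surface_differential A f p Y"
  have atlas: "smooth_atlas M A"
    using assms(1) by (simp add: orientable_surface_def smooth_surface_def)
  have f: "smooth_on_surface A f" "f ` topspace M \<subseteq> sphere 0 1"
    using assms(2) by (simp_all add: immersion_into_def S3_def)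
  have eta_field: "\<eta> \<in> fields_along M A f (sphere 0 1)"
    using assms(3) by (simp add: unit_normal_field_def S3_def)
  then have eta: "smooth_on_surface A \<eta>" "\<And>q. q \<in> topspace M \<Longrightarrow> f q \<bullet> \<eta> q = 0"
    by (simp_all add: fields_along_unit_sphere[OF f(2)])
  have ff: "f p \<bullet> f p = 1" using f(2) assms(6) by (auto simp: norm_eq_1[symmetric])
  have df: "f p \<bullet> surface_differential A f p Z = 0" for Z
    by (rule surface_differential_orthogonal[OF atlas assms(6) f])
  have "gauss_map f \<eta> q = wedge (\<eta> q) (f q)" if "q \<in> topspace M" for q
    unfolding gauss_map_def using that f(2) eta(2) by (intro Gamma_eq_wedge) (auto simp: S3_def)
  then have "surface_differential A (gauss_map f \<eta>) p X =
      surface_differential A (\<lambda>q. wedge (\<eta> q) (f q)) p X"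
    by (intro surface_differential_cong[OF atlas assms(6)]
        smooth_on_surface_bilinear[OF bounded_bilinear_wedge eta(1) f(1)]) simp
  then have dN: "surface_differential A (gauss_map f \<eta>) p X =
      wedge (\<eta> p) (surface_differential A f p X) + wedge (surface_differential A \<eta> p X) (f p)"
    using surface_differential_bilinear[OF atlas assms(6) bounded_bilinear_wedge eta(1) f(1)]
    by simp
  have "Gamma (f p) Y' = wedge Y' (f p)"
    using f(2) assms(6) df by (intro Gamma_eq_wedge) (auto simp: S3_def Y'_def)
  then have "lie_inner (surface_differential A (gauss_map f \<eta>) p X) (Gamma (f p) Y') =
      lie_inner (wedge (\<eta> p) (surface_differential A f p X)) (wedge Y' (f p)) +
      lie_inner (wedge (surface_differential A \<eta> p X) (f p)) (wedge Y' (f p))"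
    by (simp add: dN lie_inner_eq inner_add_left add_divide_distrib)
  also have "\<dots> = surface_differential A \<eta> p X \<bullet> Y'"
    using df eta(2)[OF assms(6)] ff by (simp add: lie_inner_wedge inner_commute Y'_def)
  also have "\<dots> = nab p X \<eta> \<bullet> Y'"
    using induced_connection_unit_sphere[OF atlas f _ _ assms(6,7) eta_field, of D nab Y']
      assms(4,5) df by (simp add: S3_def Y'_def)
  finally show ?thesis by (simp add: shape_operator_def Y'_def)
qed

end
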